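(* Let $L_{\mathcal{L}}\subseteq\{0,1\}^*$ be the set of all binary words that are Lyndon words with respect to the order $0<1$ or with respect to the order $1<0$, and let $L=\{w\in L_{\mathcal{L}}\mid |w|\text{ is odd}\}$. Then $\mathcal{G}_L$ is exactly the class of bipartite graphs.
   Context: All graphs are finite, simple, undirected, with nonempty vertex sets, and graph classes are considered up to isomorphism; a graph is bipartite if its vertex set is the union of two disjoint independent sets. Given a strict linear order on an alphabet, extended lexicographically to words (a proper prefix is smaller), a Lyndon word is a nonempty word $w$ that is not of the form $u^k$ with $k\geq 2$ and that is lexicographically smallest among its conjugates (words $vu$ where $w=uv$). For an alphabet $V$ and distinct $u,v\in V$, $h_{u,v}:V^*\to\{0,1\}^*$ is the monoid morphism with $u\mapsto 0$, $v\mapsto 1$ and $x\mapsto\lambda$ (empty word) for all other letters $x$. For a language $L\subseteq\{0,1\}^*$ closed under exchanging 0 and 1 and a nonempty word $w$ whose set of occurring letters is $V$, $G(L,w)$ is the graph with vertex set $V$ in which distinct $u,v$ are adjacent iff $h_{u,v}(w)\in L$. $\mathcal{G}_L$ is the class of all graphs isomorphic to some $G(L,w)$. *)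

theory Defs
  imports Graph_Theory.Pair_Digraph Graph_Theory.Digraph_Isomorphism
begin

text \<open>
  A finite simple undirected graph with nonempty vertex set is a \<^locale>\<open>pair_graph\<close> (finite,
  loop-free, symmetric arc relation) with at least one vertex; an edge is a pair of opposite arcs.
\<close>
definition simple_graph :: "'a pair_pre_digraph \<Rightarrow> bool" where
  "simple_graph G \<longleftrightarrow> pair_graph G \<and> pverts G \<noteq> {}"

definition independent_set :: "'a pair_pre_digraph \<Rightarrow> 'a set \<Rightarrow> bool" where
  "independent_set G A \<longleftrightarrow> A \<subseteq> pverts G \<and> (\<forall>u\<in>A. \<forall>v\<in>A. (u, v) \<notin> parcs G)"

definition bipartite :: "'a pair_pre_digraph \<Rightarrow> bool" where
  "bipartite G \<longleftrightarrow>
    (\<exists>A B. pverts G = A \<union> B \<and> A \<inter> B = {} \<and> independent_set G A \<and> independent_set G B)"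

definition primitive :: "'a list \<Rightarrow> bool" where
  "primitive w \<longleftrightarrow> \<not> (\<exists>u k. k \<ge> (2::nat) \<and> w = concat (replicate k u))"

text \<open>
  \<^term>\<open>r\<close> is the strict linear order on the alphabet. In \<^term>\<open>lexord r\<close> a proper prefix is smaller.
\<close>
definition lyndon :: "('a \<times> 'a) set \<Rightarrow> 'a list \<Rightarrow> bool" where
  "lyndon r w \<longleftrightarrow> w \<noteq> [] \<and> primitive w \<and>
    (\<forall>u v. w = u @ v \<longrightarrow> v @ u = w \<or> (w, v @ u) \<in> lexord r)"

text \<open>Binary words are lists over \<^typ>\<open>bool\<close>, with \<^term>\<open>False\<close> for 0 and \<^term>\<open>True\<close> for 1.\<close>
definition binary_lyndon_words :: "bool list set" where
  "binary_lyndon_words = {w. lyndon {(False, True)} w \<or> lyndon {(True, False)} w}"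

definition odd_binary_lyndon_words :: "bool list set" where
  "odd_binary_lyndon_words = {w \<in> binary_lyndon_words. odd (length w)}"

definition swap_closed :: "bool list set \<Rightarrow> bool" where
  "swap_closed L \<longleftrightarrow> (\<forall>w\<in>L. map Not w \<in> L)"

definition proj2 :: "'a \<Rightarrow> 'a \<Rightarrow> 'a list \<Rightarrow> bool list" where
  "proj2 u v w =
    concat (map (\<lambda>x. if x = u then [False] else if x = v then [True] else []) w)"

text \<open>\<open>G(L,w)\<close>; only meaningful for nonempty \<^term>\<open>w\<close> and \<^term>\<open>swap_closed L\<close>.\<close>
definition word_graph :: "bool list set \<Rightarrow> 'a list \<Rightarrow> 'a pair_pre_digraph" where
  "word_graph L w =
    \<lparr> pverts = set w,
      parcs = {(u, v). u \<in> set w \<and> v \<in> set w \<and> u \<noteq> v \<and> proj2 u v w \<in> L} \<rparr>"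

text \<open>
  \<open>\<G>\<^sub>L\<close>, restricted to graphs whose vertices lie in \<^typ>\<open>'a\<close>. The words range over \<^typ>\<open>nat\<close>:
  since membership is up to isomorphism and the set of letters of a word is finite, this covers
  words over arbitrary alphabets.
\<close>
definition word_graph_class :: "bool list set \<Rightarrow> 'a pair_pre_digraph set" where
  "word_graph_class L =
    {G. simple_graph G \<and>
        (\<exists>w :: nat list. w \<noteq> [] \<and> digraph_iso (with_proj (word_graph L w)) (with_proj G))}"

lemma concat_replicate_map: "concat (replicate k (map f u)) = map f (concat (replicate k u))"
  by (induction k) auto

lemma primitive_map_Not: "primitive w \<Longrightarrow> primitive (map Not w)"
proof -
  assume p: "primitive w"
  have "False" if "k \<ge> 2" "map Not w = concat (replicate k u)" for u and k :: nat
  proof -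
    have "w = map Not (map Not w)" by (simp add: comp_def)
    also have "\<dots> = concat (replicate k (map Not u))"
      using that(2) by (simp only: concat_replicate_map)
    finally show False using p that(1) unfolding primitive_def by blast
  qed
  then show ?thesis unfolding primitive_def by blast
qed

lemma lyndon_map_Not:
  assumes "lyndon r w"
  shows "lyndon {(a, b). (\<not> a, \<not> b) \<in> r} (map Not w)"
proof -
  let ?r = "{(a, b). (\<not> a, \<not> b) \<in> r}"
  have lex: "(map Not x, map Not y) \<in> lexord ?r" if xy: "(x, y) \<in> lexord r" for x y
  proof -
    consider a v where "y = x @ a # v"
      | u a b v z where "(a, b) \<in> r" "x = u @ a # v" "y = u @ b # z"
      using xy unfolding lexord_def by blast
    then show ?thesis
    proof cases
      case 1
      then show ?thesis unfolding lexord_def by auto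
    next
      case 2
      have "(\<not> a, \<not> b) \<in> ?r" using 2(1) by simp
      moreover have "map Not x = map Not u @ (\<not> a) # map Not v"
        "map Not y = map Not u @ (\<not> b) # map Not z" using 2 by auto
      ultimately show ?thesis unfolding lexord_def by blast
    qed
  qed
  have "v @ u = map Not w \<or> (map Not w, v @ u) \<in> lexord ?r" if "map Not w = u @ v" for u v
  proof -
    have "w = map Not (map Not w)" by (simp add: comp_def)
    then have "w = map Not u @ map Not v" using that by simp
    then have "map Not v @ map Not u = w \<or> (w, map Not v @ map Not u) \<in> lexord r"
      using assms unfolding lyndon_def by blast
    moreover have "map Not (map Not v @ map Not u) = v @ u" by (simp add: comp_def)
    ultimately show ?thesis using lex by metis
  qed
  then show ?thesis using assms primitive_map_Not unfolding lyndon_def by blast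
qed

lemma swap_closed_odd_binary_lyndon_words: "swap_closed odd_binary_lyndon_words"
proof -
  have "{(a, b). (\<not> a, \<not> b) \<in> {(False, True)}} = {(True, False)}"
    "{(a, b). (\<not> a, \<not> b) \<in> {(True, False)}} = {(False, True)}" by auto
  then have "lyndon {(False, True)} w \<Longrightarrow> lyndon {(True, False)} (map Not w)"
    "lyndon {(True, False)} w \<Longrightarrow> lyndon {(False, True)} (map Not w)" for w
    using lyndon_map_Not by metis+
  then show ?thesis
    unfolding swap_closed_def odd_binary_lyndon_words_def binary_lyndon_words_def by auto
qed

lemma proj2_swap: "u \<noteq> v \<Longrightarrow> proj2 v u w = map Not (proj2 u v w)"
  unfolding proj2_def by (induction w) auto

lemma simple_graph_word_graph:
  assumes "swap_closed L" "w \<noteq> []"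
  shows "simple_graph (word_graph L w)"
proof -
  let ?G = "word_graph L w"
  have "finite (parcs ?G)"
    by (rule finite_subset[of _ "set w \<times> set w"]) (auto simp: word_graph_def)
  moreover have "sym (parcs ?G)"
    using assms(1) by (auto simp: sym_def word_graph_def swap_closed_def proj2_swap)
  ultimately have "pair_graph ?G"
    by unfold_locales (auto simp: symmetric_def word_graph_def)
  then show ?thesis using assms(2) by (simp add: simple_graph_def word_graph_def)
qed

end

theory Submission
  imports Defs
begin

text \<open>
  Adjacent letters have occurrence counts of different parity, so the parity of the count is a
  bipartition. Conversely, let \<open>A\<close>, \<open>B\<close> be the parts of a bipartite graph and \<open>N\<^sub>b \<subseteq> A\<close> the
  set of non-neighbours of \<open>b \<in> B\<close>. In the word \<open>A A B \<Prod>\<^sub>b ((N\<^sub>b (B - b))\<^sup>4 B B)\<close> letters of \<open>A\<close>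
  occur an even and letters of \<open>B\<close> an odd number of times, so only pairs \<open>a \<in> A\<close>, \<open>b \<in> B\<close> matter.
  Their projection starts with \<open>001\<close> and ends with \<open>1\<close>. All later runs of \<open>0\<close> have
  length at most 1 if \<open>a\<close> and \<open>b\<close> are adjacent, which makes the projection Lyndon; otherwise
  the factor of \<open>b\<close> contains a run \<open>0000\<close>, and rotating to it gives a smaller conjugate.
\<close>

section \<open>Projections\<close>

lemma proj2_Nil [simp]: "proj2 u v [] = []"
  by (simp add: proj2_def)

lemma proj2_Cons [simp]:
  "proj2 u v (x # w) = (if x = u then [False] else if x = v then [True] else []) @ proj2 u v w"
  by (simp add: proj2_def)

lemma proj2_append [simp]: "proj2 u v (w @ w') = proj2 u v w @ proj2 u v w'"
  by (simp add: proj2_def)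

lemma proj2_concat: "proj2 u v (concat ws) = concat (map (proj2 u v) ws)"
  by (induction ws) simp_all

lemma proj2_notin: "u \<notin> set w \<Longrightarrow> v \<notin> set w \<Longrightarrow> proj2 u v w = []"
  by (induction w) auto

lemma proj2_distinct_left:
  "distinct w \<Longrightarrow> v \<notin> set w \<Longrightarrow> proj2 u v w = (if u \<in> set w then [False] else [])"
  by (induction w) (auto simp: proj2_notin)

lemma proj2_distinct_right:
  "distinct w \<Longrightarrow> u \<notin> set w \<Longrightarrow> proj2 u v w = (if v \<in> set w then [True] else [])"
  by (induction w) (auto simp: proj2_notin)

lemma length_proj2: "u \<noteq> v \<Longrightarrow> length (proj2 u v w) = count_list w u + count_list w v"
  by (induction w) auto

lemma proj2_map:
  assumes "inj_on f S" "u \<in> S" "v \<in> S" "set w \<subseteq> S"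
  shows "proj2 (f u) (f v) (map f w) = proj2 u v w"
  using assms(4) by (induction w) (use assms(1-3) in \<open>auto simp: inj_on_eq_iff\<close>)

lemma proj2_in_swap_closed_commute:
  assumes "swap_closed L" "u \<noteq> v"
  shows "proj2 u v w \<in> L \<longleftrightarrow> proj2 v u w \<in> L"
  using assms proj2_swap[of u v w] proj2_swap[of v u w] unfolding swap_closed_def by metis

section \<open>Lyndon words\<close>

text \<open>A proper power is its own conjugate, since rotating one copy of its root leaves it
  fixed. Strict inequality for all nontrivial rotations therefore already yields
  primitivity.\<close>

lemma lyndonI_strict:
  assumes "w \<noteq> []" and irr: "\<And>x. (x, x) \<notin> r"
    and less: "\<And>u v. w = u @ v \<Longrightarrow> u \<noteq> [] \<Longrightarrow> v \<noteq> [] \<Longrightarrow> (w, v @ u) \<in> lexord r"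
  shows "lyndon r w"
proof -
  have "False" if k: "k \<ge> 2" and w: "w = concat (replicate k u)" for u and k :: nat
  proof -
    obtain j where j: "k = Suc (Suc j)"
      using k by (metis add_2_eq_Suc le_Suc_ex)
    define v where "v = concat (replicate (Suc j) u)"
    have uv: "w = u @ v" using w j by (simp add: v_def)
    have comm: "concat (replicate n u) @ u = u @ concat (replicate n u)" for n
      by (induction n) auto
    have "u \<noteq> []"
    proof
      assume "u = []"
      then have "w = []" using w by simp
      then show False using \<open>w \<noteq> []\<close> by contradiction
    qed
    then have "v \<noteq> []" by (simp add: v_def)
    have "(w, v @ u) \<in> lexord r" by (rule less) fact+
    moreover have "v @ u = w" unfolding uv unfolding v_def by (rule comm)
    ultimately show False using lexord_irreflexive[of r w] irr by simp
  qed
  then have "primitive w" unfolding primitive_def by blast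
  moreover have "v @ u = w \<or> (w, v @ u) \<in> lexord r" if "w = u @ v" for u v
  proof (cases "u = [] \<or> v = []")
    case True
    then have "v @ u = w" unfolding that by auto
    then show ?thesis ..
  qed (use less[OF that] in blast)
  ultimately show ?thesis using \<open>w \<noteq> []\<close> unfolding lyndon_def by blast
qed

text \<open>This is the language of all products of the words 1 and 01. Forbidding a final 0 makes
  it closed under concatenation.\<close>

fun isolated_zeros :: "bool list \<Rightarrow> bool" where
  "isolated_zeros [] \<longleftrightarrow> True"
| "isolated_zeros (True # w) \<longleftrightarrow> isolated_zeros w"
| "isolated_zeros (False # True # w) \<longleftrightarrow> isolated_zeros w"
| "isolated_zeros _ \<longleftrightarrow> False"

lemma isolated_zeros_append:
  "isolated_zeros w \<Longrightarrow> isolated_zeros w' \<Longrightarrow> isolated_zeros (w @ w')"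
  by (induction w rule: isolated_zeros.induct) auto

lemma isolated_zeros_concat:
  "(\<And>w. w \<in> set ws \<Longrightarrow> isolated_zeros w) \<Longrightarrow> isolated_zeros (concat ws)"
  by (induction ws) (auto intro: isolated_zeros_append)

lemma isolated_zeros_suffix:
  assumes "isolated_zeros (u @ v)" "v \<noteq> []"
  shows "(\<exists>v'. v = True # v') \<or> (\<exists>v'. v = False # True # v')"
  using assms(1)
proof (induction u rule: isolated_zeros.induct)
  case 1
  then show ?case using assms(2) by (cases v rule: isolated_zeros.cases) auto
next
  \<comment> \<open>Here the cut splits a factor 01, so the suffix begins with the remaining
    1.\<close>
  case "4_1"
  then show ?case using assms(2) by (cases v) (auto elim: isolated_zeros.elims)
qed simp_all

text \<open>Without its first 0 the word is a product of factors 1 and 01. Every proper nonempty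
  suffix thus starts with 1 or 01, which exceeds the prefix 00 of the word, and so does the rotation
  to that suffix.\<close>

lemma lyndon_double_zero_isolated_zeros:
  assumes "isolated_zeros r"
  shows "lyndon {(False, True)} (False # False # True # r)" (is "lyndon ?r ?w")
proof (rule lyndonI_strict)
  fix u v assume uv: "?w = u @ v" "u \<noteq> []" "v \<noteq> []"
  obtain u' where u': "u = False # u'" "False # True # r = u' @ v"
    using uv(1,2) by (cases u) auto
  have "isolated_zeros (u' @ v)" using assms u'(2) by (metis isolated_zeros.simps(3))
  from isolated_zeros_suffix[OF this uv(3)] show "(?w, v @ u) \<in> lexord ?r" by auto
qed auto

text \<open>Both orders have to be refuted. For 1 < 0, moving the prefix 00 to the end gives a
  smaller conjugate starting with 1; for 0 < 1, the rotation to 000 beats the prefix 001.\<close>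

lemma not_lyndon_triple_zero:
  assumes "w = False # False # True # r" "w = u @ False # False # False # v"
  shows "w \<notin> binary_lyndon_words"
proof -
  have rotate: "\<not> lyndon s w" if "w = x @ y" "y @ x \<noteq> w" "(w, y @ x) \<notin> lexord s" for s x y
    using that unfolding lyndon_def by blast
  have "\<not> lyndon {(True, False)} w"
    by (rule rotate[of "[False, False]" "True # r"]) (simp_all add: assms(1))
  moreover have "\<not> lyndon {(False, True)} w"
  proof (rule rotate[OF assms(2)])
    show "(False # False # False # v) @ u \<noteq> w"
      "(w, (False # False # False # v) @ u) \<notin> lexord {(False, True)}"
      by (simp_all add: assms(1))
  qed
  ultimately show ?thesis by (simp add: binary_lyndon_words_def)
qed

section \<open>A word for a bipartite graph\<close>

text \<open>Leaving out \<open>b\<close> lets the zeros of repeated units run together in a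
  projection to a non-neighbour and \<open>b\<close>. The unit of any other letter of
  \<open>bs\<close> still contains \<open>b\<close>, which separates them.\<close>

definition bipartite_unit :: "('a \<times> 'a) set \<Rightarrow> 'a list \<Rightarrow> 'a list \<Rightarrow> 'a \<Rightarrow> 'a list" where
  "bipartite_unit E as bs b = filter (\<lambda>a. (a, b) \<notin> E) as @ filter (\<lambda>c. c \<noteq> b) bs"

text \<open>Four is the least even exponent that produces at least three consecutive zeros; evenness
  keeps the block neutral for the parity of every letter.\<close>

definition bipartite_block :: "('a \<times> 'a) set \<Rightarrow> 'a list \<Rightarrow> 'a list \<Rightarrow> 'a \<Rightarrow> 'a list" where
  "bipartite_block E as bs b = (let c = bipartite_unit E as bs b in c @ c @ c @ c @ bs @ bs)"

definition bipartite_word :: "('a \<times> 'a) set \<Rightarrow> 'a list \<Rightarrow> 'a list \<Rightarrow> 'a list" where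
  "bipartite_word E as bs = as @ as @ bs @ concat (map (bipartite_block E as bs) bs)"

lemma set_bipartite_word: "set (bipartite_word E as bs) = set as \<union> set bs"
  by (auto simp: bipartite_word_def bipartite_block_def bipartite_unit_def Let_def)

lemma even_count_bipartite_word:
  "even (count_list (bipartite_word E as bs) x) \<longleftrightarrow> even (count_list bs x)"
proof -
  \<comment> \<open>The list of factors is generalized to \<open>cs\<close>, because
    \<open>bs\<close> also occurs inside each block and must stay fixed during the
    induction.\<close>
  have "even (count_list (concat (map (bipartite_block E as bs) cs)) x)" for cs
    by (induction cs) (auto simp: bipartite_block_def Let_def)
  from this[of bs] show ?thesis by (auto simp: bipartite_word_def)
qed

lemma count_list_distinct: "distinct xs \<Longrightarrow> count_list xs x = (if x \<in> set xs then 1 else 0)"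
  by (induction xs) auto

lemma bipartite_word_proj2_iff:
  assumes "distinct as" "distinct bs" "set as \<inter> set bs = {}" and a: "a \<in> set as" and b: "b \<in> set bs"
  shows "proj2 a b (bipartite_word E as bs) \<in> odd_binary_lyndon_words \<longleftrightarrow> (a, b) \<in> E"
proof -
  let ?w = "proj2 a b (bipartite_word E as bs)"
  have ab: "a \<notin> set bs" "b \<notin> set as" "a \<noteq> b" using assms by auto
  have unit: "proj2 a b (bipartite_unit E as bs c) =
      (if (a, c) \<in> E then [] else [False]) @ (if c = b then [] else [True])" for c
    using assms ab
    by (simp add: bipartite_unit_def proj2_distinct_left proj2_distinct_right)
  have pas: "proj2 a b as = [False]" and pbs: "proj2 a b bs = [True]"
    using assms ab by (simp_all add: proj2_distinct_left proj2_distinct_right)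
  define r where "r = concat (map (\<lambda>c. proj2 a b (bipartite_block E as bs c)) bs)"
  have w: "?w = False # False # True # r"
    by (simp add: bipartite_word_def pas pbs proj2_concat r_def comp_def)
  have "odd (length ?w)"
    using assms ab by (simp add: length_proj2 even_count_bipartite_word count_list_distinct)
  moreover have "?w \<in> binary_lyndon_words" if "(a, b) \<in> E"
  proof -
    \<comment> \<open>The unit of a letter other than \<open>b\<close> projects to 1 or 01, and
      adjacency makes the unit of \<open>b\<close> project to the empty word.\<close>
    have "isolated_zeros (proj2 a b (bipartite_block E as bs c))" for c
      using that by (auto simp: bipartite_block_def Let_def unit pbs)
    then have "isolated_zeros r"
      unfolding r_def by (intro isolated_zeros_concat) auto
    then show ?thesis
      using lyndon_double_zero_isolated_zeros w by (simp add: binary_lyndon_words_def)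
  qed
  moreover have "?w \<notin> binary_lyndon_words" if "(a, b) \<notin> E"
  proof -
    obtain bs1 bs2 where "bs = bs1 @ b # bs2" using split_list[OF b] by blast
    \<comment> \<open>The projection 000011 is split as 000 followed by 011 to expose the three
      zeros.\<close>
    moreover have "proj2 a b (bipartite_block E as bs b) =
        False # False # False # [False, True, True]"
      using that by (simp add: bipartite_block_def Let_def unit pbs)
    ultimately have "\<exists>x y. r = x @ False # False # False # y"
      unfolding r_def by fastforce
    then obtain x y where "r = x @ False # False # False # y" by blast
    then show ?thesis
      using not_lyndon_triple_zero[OF w, of "False # False # True # x" y] w by simp
  qed
  ultimately show ?thesis by (auto simp: odd_binary_lyndon_words_def)
qed

text \<open>Pairs across the parts reduce to \<open>bipartite_word_proj2_iff\<close>, after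
  exchanging 0 and 1 if they come in the other direction. Pairs within a part have projections of
  even length.\<close>

lemma word_graph_bipartite_word:
  assumes "distinct as" "distinct bs" "set as \<inter> set bs = {}" "sym E"
    and E: "E \<subseteq> set as \<times> set bs \<union> set bs \<times> set as"
  shows "word_graph odd_binary_lyndon_words (bipartite_word E as bs) =
    \<lparr> pverts = set as \<union> set bs, parcs = E \<rparr>"
proof -
  let ?w = "bipartite_word E as bs" and ?L = odd_binary_lyndon_words
  have len: "even (length (proj2 u v ?w)) \<longleftrightarrow> (u \<in> set bs \<longleftrightarrow> v \<in> set bs)" if "u \<noteq> v" for u v
    using assms(2) that by (simp add: length_proj2 even_count_bipartite_word count_list_distinct)
  have adj: "proj2 u v ?w \<in> ?L \<longleftrightarrow> (u, v) \<in> E"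
    if uv: "u \<noteq> v" "u \<in> set as \<union> set bs" "v \<in> set as \<union> set bs" for u v
  proof -
    consider "u \<in> set as" "v \<in> set bs" | "u \<in> set bs" "v \<in> set as"
      | "u \<in> set bs \<longleftrightarrow> v \<in> set bs" using uv by blast
    then show ?thesis
    proof cases
      case 1
      then show ?thesis using bipartite_word_proj2_iff assms(1-3) by metis
    next
      case 2
      then have "proj2 v u ?w \<in> ?L \<longleftrightarrow> (v, u) \<in> E"
        using bipartite_word_proj2_iff assms(1-3) by metis
      then show ?thesis
        using proj2_in_swap_closed_commute[OF swap_closed_odd_binary_lyndon_words uv(1)] \<open>sym E\<close>
        by (metis symD)
    next
      case 3
      then have "(u, v) \<notin> E" using E assms(3) by blast
      then show ?thesis using len[OF uv(1)] 3 by (simp add: odd_binary_lyndon_words_def)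
    qed
  qed
  have "u \<noteq> v \<and> u \<in> set as \<union> set bs \<and> v \<in> set as \<union> set bs" if "(u, v) \<in> E" for u v
    using that E assms(3) by blast
  then show ?thesis
    using adj by (auto simp: word_graph_def set_bipartite_word)
qed

section \<open>Isomorphisms\<close>

lemma digraph_iso_with_projI:
  assumes "pair_wf_digraph G" "inj_on f (pverts G)"
    and "pverts H = f ` pverts G" "parcs H = map_prod f f ` parcs G"
  shows "digraph_iso (with_proj G) (with_proj H)"
proof -
  interpret pair_wf_digraph G by fact
  let ?hom = "\<lparr>iso_verts = f, iso_arcs = map_prod f f, iso_head = snd, iso_tail = fst\<rparr>"
  have "inj_on (map_prod f f) (parcs G)"
  proof (rule inj_on_subset)
    show "inj_on (map_prod f f) (pverts G \<times> pverts G)"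
      using assms(2) by (intro map_prod_inj_on)
    show "parcs G \<subseteq> pverts G \<times> pverts G"
      using in_arcsD1 in_arcsD2 by auto
  qed
  then have "digraph_isomorphism ?hom"
    using assms(2) wf_digraph_axioms by (auto simp: digraph_isomorphism_def)
  moreover have "with_proj H = app_iso ?hom (with_proj G)"
    using assms(3,4) by (simp add: app_iso_def with_proj_def)
  ultimately show ?thesis unfolding digraph_iso_def by blast
qed

text \<open>The library's isomorphisms carry a separate map on arcs. As tail and head are
  \<open>fst\<close> and \<open>snd\<close> on both sides, that map is determined by the one on
  vertices.\<close>

lemma digraph_iso_with_projE:
  assumes "digraph_iso (with_proj G) (with_proj H)"
  obtains f where "inj_on f (pverts G)"
    "pverts H = f ` pverts G" "parcs H = map_prod f f ` parcs G"
proof -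
  obtain h where h: "pre_digraph.digraph_isomorphism (with_proj G) h"
    and H: "with_proj H = app_iso h (with_proj G)"
    using assms unfolding digraph_iso_def by blast
  have tl: "iso_tail h = fst" "iso_head h = snd"
    using H by (simp_all add: app_iso_def with_proj_def)
  have "iso_arcs h e = map_prod (iso_verts h) (iso_verts h) e" if "e \<in> parcs G" for e
    using h that by (auto simp: pre_digraph.digraph_isomorphism_def tl prod_eq_iff)
  moreover have "parcs H = iso_arcs h ` parcs G" "pverts H = iso_verts h ` pverts G"
    using H by (simp_all add: app_iso_def with_proj_def)
  ultimately show ?thesis
    using h by (intro that[of "iso_verts h"]) (auto simp: pre_digraph.digraph_isomorphism_def)
qed

text \<open>The vertex map carries the two parts over. It is injective only on
  \<open>pverts G\<close>, and \<open>arcs\<close> places the endpoints of arcs there, so an arc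
  inside an image comes from one inside the part.\<close>

lemma bipartite_iso:
  assumes "digraph_iso (with_proj G) (with_proj H)" "bipartite G"
    and arcs: "parcs G \<subseteq> pverts G \<times> pverts G"
  shows "bipartite H"
proof -
  obtain f where f: "inj_on f (pverts G)" "pverts H = f ` pverts G" "parcs H = map_prod f f ` parcs G"
    using digraph_iso_with_projE[OF assms(1)] .
  obtain A B where AB: "pverts G = A \<union> B" "A \<inter> B = {}"
    "independent_set G A" "independent_set G B"
    using assms(2) unfolding bipartite_def by blast
  have "independent_set H (f ` C)" if "independent_set G C" for C
  proof -
    have C: "C \<subseteq> pverts G" "\<And>u v. u \<in> C \<Longrightarrow> v \<in> C \<Longrightarrow> (u, v) \<notin> parcs G"
      using that by (auto simp: independent_set_def)
    have "(f u, f v) \<notin> parcs H" if uv: "u \<in> C" "v \<in> C" for u v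
    proof
      assume "(f u, f v) \<in> parcs H"
      then obtain x y where xy: "(x, y) \<in> parcs G" "f x = f u" "f y = f v"
        unfolding f(3) by auto
      then have "x = u" "y = v"
        using f(1) arcs C(1) uv by (auto simp: inj_on_def)
      then show False using C(2) uv xy by simp
    qed
    then show ?thesis using C(1) f(2) by (auto simp: independent_set_def)
  qed
  moreover have "f ` A \<inter> f ` B = {}"
    using AB(1,2) f(1) inj_on_image_Int[of f "pverts G" A B] by auto
  ultimately show ?thesis
    unfolding bipartite_def using AB f(2) by (intro exI[of _ "f ` A"] exI[of _ "f ` B"]) auto
qed

lemma word_graph_map:
  assumes "inj_on f (set w)"
  shows "word_graph L (map f w) =
    \<lparr> pverts = f ` pverts (word_graph L w), parcs = map_prod f f ` parcs (word_graph L w) \<rparr>"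
proof -
  have "proj2 (f u) (f v) (map f w) = proj2 u v w" "f u = f v \<longleftrightarrow> u = v"
    if "u \<in> set w" "v \<in> set w" for u v
    using proj2_map[OF assms] that assms by (auto simp: inj_on_eq_iff)
  then show ?thesis by (force simp: word_graph_def)
qed

text \<open>The class speaks of words over \<open>nat\<close>, so the finitely many letters of
  \<open>w\<close> are renamed injectively by numbers.\<close>

lemma word_graph_in_class:
  assumes "simple_graph (word_graph L w)" "w \<noteq> []"
  shows "word_graph L w \<in> word_graph_class L"
proof -
  let ?G = "word_graph L w"
  obtain f :: "'a \<Rightarrow> nat" where f: "inj_on f (set w)"
    using finite_imp_inj_to_nat_seg[OF finite_set] by metis
  let ?H = "word_graph L (map f w)"
  have G: "pair_wf_digraph ?G" by unfold_locales (auto simp: word_graph_def)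
  then interpret G: pair_wf_digraph ?G .
  have "digraph_iso (with_proj ?G) (with_proj ?H)"
    using f by (intro digraph_iso_with_projI[OF G, of f])
      (simp_all add: word_graph_map[OF f], simp add: word_graph_def)
  then have "digraph_iso (with_proj ?H) (with_proj ?G)"
    by (rule digraph_iso_swap[OF G.wf_digraph_axioms])
  then show ?thesis
    using assms unfolding word_graph_class_def by (intro CollectI conjI exI[of _ "map f w"]) auto
qed

section \<open>Bipartiteness and the two inclusions\<close>

lemma bipartite_word_graph_odd:
  assumes "\<And>w. w \<in> L \<Longrightarrow> odd (length w)"
  shows "bipartite (word_graph L w)"
proof -
  let ?A = "{u \<in> set w. even (count_list w u)}" and ?B = "{u \<in> set w. odd (count_list w u)}"
  \<comment> \<open>By \<open>length_proj2\<close> this sum is the length of a word of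
    \<open>L\<close>.\<close>
  have "odd (count_list w u + count_list w v)" if "(u, v) \<in> parcs (word_graph L w)" for u v
    using assms[of "proj2 u v w"] that by (auto simp: word_graph_def length_proj2)
  then have "independent_set (word_graph L w) ?A" "independent_set (word_graph L w) ?B"
    by (fastforce simp: independent_set_def word_graph_def)+
  moreover have "pverts (word_graph L w) = ?A \<union> ?B" "?A \<inter> ?B = {}"
    by (auto simp: word_graph_def)
  ultimately show ?thesis unfolding bipartite_def by blast
qed

theorem mainTheorem12:
  shows "(word_graph_class odd_binary_lyndon_words :: 'a pair_pre_digraph set)
    = {G. simple_graph G \<and> bipartite G}"
proof (intro set_eqI iffI)
  fix G :: "'a pair_pre_digraph"
  assume "G \<in> word_graph_class odd_binary_lyndon_words"
  then obtain w :: "nat list" where "simple_graph G"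
    and iso: "digraph_iso (with_proj (word_graph odd_binary_lyndon_words w)) (with_proj G)"
    unfolding word_graph_class_def by blast
  moreover have "bipartite G"
    by (rule bipartite_iso[OF iso bipartite_word_graph_odd])
      (auto simp: odd_binary_lyndon_words_def word_graph_def)
  ultimately show "G \<in> {G. simple_graph G \<and> bipartite G}" by simp
next
  fix G :: "'a pair_pre_digraph"
  assume "G \<in> {G. simple_graph G \<and> bipartite G}"
  then have G: "simple_graph G" "pair_graph G" "pverts G \<noteq> {}" and "bipartite G"
    by (auto simp: simple_graph_def)
  then obtain A B where AB: "pverts G = A \<union> B" "A \<inter> B = {}"
    "independent_set G A" "independent_set G B"
    unfolding bipartite_def by blast
  interpret pair_graph G by fact
  have "finite (A \<union> B)" using finite_verts AB(1) by simp
  then have "finite A" "finite B" by simp_all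
  obtain as where as: "distinct as" "set as = A"
    using finite_distinct_list[OF \<open>finite A\<close>] by blast
  obtain bs where bs: "distinct bs" "set bs = B"
    using finite_distinct_list[OF \<open>finite B\<close>] by blast
  have "sym (parcs G)" using sym_arcs by (simp add: symmetric_def)
  have arcs: "parcs G \<subseteq> A \<times> B \<union> B \<times> A"
  proof (rule subrelI)
    fix u v assume uv: "(u, v) \<in> parcs G"
    then have "u \<in> A \<union> B" "v \<in> A \<union> B" using AB(1) in_arcsD1 in_arcsD2 by metis+
    then show "(u, v) \<in> A \<times> B \<union> B \<times> A"
      using uv AB(3,4) by (auto simp: independent_set_def)
  qed
  \<comment> \<open>The letters are the vertices of \<open>G\<close> themselves, so the word graph
    equals \<open>G\<close>; passing to \<open>nat\<close> is left to
    \<open>word_graph_in_class\<close>.\<close>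
  let ?w = "bipartite_word (parcs G) as bs"
  have "word_graph odd_binary_lyndon_words ?w = \<lparr> pverts = A \<union> B, parcs = parcs G \<rparr>"
    using word_graph_bipartite_word[of as bs "parcs G"] as bs AB(2) \<open>sym (parcs G)\<close> arcs by simp
  also have "\<dots> = G" by (simp flip: AB(1))
  finally have word_graph: "word_graph odd_binary_lyndon_words ?w = G" .
  have "set ?w \<noteq> {}"
    using G(3) as(2) bs(2) AB(1) by (simp add: set_bipartite_word)
  then have "?w \<noteq> []" by auto
  from word_graph_in_class[OF _ this, of odd_binary_lyndon_words] G(1)
  show "G \<in> word_graph_class odd_binary_lyndon_words" by (simp only: word_graph)
qed

end
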